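(* The logic $\mathsf{2CH}$ is complete with respect to chromatic hypergraph models: for every agent $a\in\mathcal A$ and every agent formula $\varphi$ of sort $a$, if $H,v\models_a\varphi$ for every chromatic hypergraph model $H$ and every view $v\in V_a$ of $H$, then $\vdash_a\varphi$; and for every world formula $\Phi$, if $H,e\models_e\Phi$ for every chromatic hypergraph model $H$ and every hyperedge $e$ of $H$, then $\vdash_e\Phi$.
   Context: Syntax. Fix a finite set $\mathcal{A}$ of agents, for each $a\in\mathcal A$ a set $AP_a$ of atomic propositions about agent $a$, and a set $AP_e$ of environment atomic propositions. The logic $\mathsf{2CH}$ has $|\mathcal A|+1$ sorts. For each $a\in\mathcal A$, agent formulas of sort $a$ are given by $\varphi ::= p_a \mid \neg\varphi \mid \varphi\wedge\psi \mid \Diamond_a\Phi$ with $p_a\in AP_a$ and $\Phi$ a world formula. World formulas are given by $\Phi ::= p_e \mid \neg\Phi \mid \Phi\wedge\Psi \mid \langle a\rangle\varphi$ with $p_e\in AP_e$, $a\in\mathcal A$, $\varphi$ of sort $a$. The connectives $\top,\bot,\vee,\to$ are the usual abbreviations, $\Box_a\Phi:=\neg\Diamond_a\neg\Phi$ (sort $a$) and $[a]\varphi:=\neg\langle a\rangle\neg\varphi$ (world sort). Proof system. $\vdash_a$ (derivability at sort $a$) and $\vdash_e$ (at world sort) are the least relations containing all instances of classical propositional tautologies at each sort, closed under modus ponens at each sort, and closed under: (Nec-a) from $\vdash_e\Phi$ infer $\vdash_a\Box_a\Phi$; (Nec-e) from $\vdash_a\varphi$ infer $\vdash_e[a]\varphi$;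 (monotonicity) from $\vdash_e\Phi\to\Psi$ infer $\vdash_a\Diamond_a\Phi\to\Diamond_a\Psi$ and $\vdash_a\Box_a\Phi\to\Box_a\Psi$; from $\vdash_a\varphi\to\psi$ infer $\vdash_e\langle a\rangle\varphi\to\langle a\rangle\psi$ and $\vdash_e[a]\varphi\to[a]\psi$; (adjunction, both directions) $\vdash_e\Phi\to[a]\psi$ iff $\vdash_a\Diamond_a\Phi\to\psi$, and $\vdash_a\varphi\to\Box_a\Psi$ iff $\vdash_e\langle a\rangle\varphi\to\Psi$; and containing the axioms $\vdash_a\varphi\to\Diamond_a\langle a\rangle\varphi$, $\vdash_a\Diamond_a\langle a\rangle\varphi\to\varphi$, and $\vdash_e\bigvee_{a\in\mathcal A}\langle a\rangle\top$. Semantics. A chromatic hypergraph is $H=(E,\{V_a,\pi_a\}_{a\in\mathcal A})$ where $E$ is a set (hyperedges/worlds), each $V_a$ is a set (views of $a$), each $\pi_a:E\rightharpoonup V_a$ is a surjective partial function, and for each $e\in E$, $\pi_a(e)$ is defined for at least one $a$. A chromatic hypergraph model adds valuations $\ell_a:AP_a\to\mathcal P(V_a)$ and $\ell_e:AP_e\to\mathcal P(E)$. Satisfaction: $H,v\models_a p_a$ iff $v\in\ell_a(p_a)$; $H,e\models_e p_e$ iff $e\in\ell_e(p_e)$; negation and conjunction classically at each sort; $H,v\models_a\Diamond_a\Phi$ iff $H,e\models_e\Phi$ for some $e\in E$ with $\pi_a(e)=v$; $H,e\models_e\langle a\rangle\varphi$ iff $\pi_a(e)$ is defined and $H,\pi_a(e)\models_a\varphi$.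 *)

theory Defs
  imports Main
begin

text \<open>
  Raw syntax. The sorts are imposed by the predicates \<open>agent_formula\<close> and \<open>world_formula\<close>
  below; the atomic propositions about agent \<open>a\<close> form the set \<open>AP a\<close> inside the type \<open>'p\<close>.
\<close>

datatype ('ag, 'p, 'q) aform =
    AProp 'p
  | ANeg "('ag, 'p, 'q) aform"
  | AConj "('ag, 'p, 'q) aform" "('ag, 'p, 'q) aform"
  | ADia 'ag "('ag, 'p, 'q) wform"
and ('ag, 'p, 'q) wform =
    WProp 'q
  | WNeg "('ag, 'p, 'q) wform"
  | WConj "('ag, 'p, 'q) wform" "('ag, 'p, 'q) wform"
  | WDia 'ag "('ag, 'p, 'q) aform"

inductive agent_formula ::
    "'ag set \<Rightarrow> ('ag \<Rightarrow> 'p set) \<Rightarrow> 'q set \<Rightarrow> 'ag \<Rightarrow> ('ag, 'p, 'q) aform \<Rightarrow> bool"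
  and world_formula ::
    "'ag set \<Rightarrow> ('ag \<Rightarrow> 'p set) \<Rightarrow> 'q set \<Rightarrow> ('ag, 'p, 'q) wform \<Rightarrow> bool"
  for A :: "'ag set" and AP :: "'ag \<Rightarrow> 'p set" and APe :: "'q set"
where
  "a \<in> A \<Longrightarrow> p \<in> AP a \<Longrightarrow> agent_formula A AP APe a (AProp p)"
| "agent_formula A AP APe a \<phi> \<Longrightarrow> agent_formula A AP APe a (ANeg \<phi>)"
| "agent_formula A AP APe a \<phi> \<Longrightarrow> agent_formula A AP APe a \<psi> \<Longrightarrow>
    agent_formula A AP APe a (AConj \<phi> \<psi>)"
| "a \<in> A \<Longrightarrow> world_formula A AP APe \<Phi> \<Longrightarrow> agent_formula A AP APe a (ADia a \<Phi>)"
| "p \<in> APe \<Longrightarrow> world_formula A AP APe (WProp p)"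
| "world_formula A AP APe \<Phi> \<Longrightarrow> world_formula A AP APe (WNeg \<Phi>)"
| "world_formula A AP APe \<Phi> \<Longrightarrow> world_formula A AP APe \<Psi> \<Longrightarrow>
    world_formula A AP APe (WConj \<Phi> \<Psi>)"
| "a \<in> A \<Longrightarrow> agent_formula A AP APe a \<phi> \<Longrightarrow> world_formula A AP APe (WDia a \<phi>)"

text \<open>
  The grammar has no constants, so \<open>\<top>\<close> and \<open>\<bottom>\<close> abbreviate \<open>\<not>(\<chi> \<and> \<not>\<chi>)\<close> and \<open>\<chi> \<and> \<not>\<chi>\<close> for some
  formula \<open>\<chi>\<close> of the sort in question, which is kept as an argument.
\<close>

abbreviation ATop :: "('ag, 'p, 'q) aform \<Rightarrow> ('ag, 'p, 'q) aform" where
  "ATop \<chi> \<equiv> ANeg (AConj \<chi> (ANeg \<chi>))"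

abbreviation AImp :: "('ag, 'p, 'q) aform \<Rightarrow> ('ag, 'p, 'q) aform \<Rightarrow> ('ag, 'p, 'q) aform" where
  "AImp \<phi> \<psi> \<equiv> ANeg (AConj \<phi> (ANeg \<psi>))"

abbreviation ABox :: "'ag \<Rightarrow> ('ag, 'p, 'q) wform \<Rightarrow> ('ag, 'p, 'q) aform" where
  "ABox a \<Phi> \<equiv> ANeg (ADia a (WNeg \<Phi>))"

abbreviation WBot :: "('ag, 'p, 'q) wform \<Rightarrow> ('ag, 'p, 'q) wform" where
  "WBot \<chi> \<equiv> WConj \<chi> (WNeg \<chi>)"

abbreviation WDisj :: "('ag, 'p, 'q) wform \<Rightarrow> ('ag, 'p, 'q) wform \<Rightarrow> ('ag, 'p, 'q) wform" where
  "WDisj \<Phi> \<Psi> \<equiv> WNeg (WConj (WNeg \<Phi>) (WNeg \<Psi>))"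

abbreviation WImp :: "('ag, 'p, 'q) wform \<Rightarrow> ('ag, 'p, 'q) wform \<Rightarrow> ('ag, 'p, 'q) wform" where
  "WImp \<Phi> \<Psi> \<equiv> WNeg (WConj \<Phi> (WNeg \<Psi>))"

abbreviation WBox :: "'ag \<Rightarrow> ('ag, 'p, 'q) aform \<Rightarrow> ('ag, 'p, 'q) wform" where
  "WBox a \<phi> \<equiv> WNeg (WDia a (ANeg \<phi>))"

datatype pform = PVar nat | PNeg pform | PConj pform pform

primrec peval :: "(nat \<Rightarrow> bool) \<Rightarrow> pform \<Rightarrow> bool" where
  "peval \<nu> (PVar n) = \<nu> n"
| "peval \<nu> (PNeg \<tau>) = (\<not> peval \<nu> \<tau>)"
| "peval \<nu> (PConj \<tau> \<rho>) = (peval \<nu> \<tau> \<and> peval \<nu> \<rho>)"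

definition tautology :: "pform \<Rightarrow> bool" where
  "tautology \<tau> \<longleftrightarrow> (\<forall>\<nu>. peval \<nu> \<tau>)"

primrec asubst :: "(nat \<Rightarrow> ('ag, 'p, 'q) aform) \<Rightarrow> pform \<Rightarrow> ('ag, 'p, 'q) aform" where
  "asubst \<sigma> (PVar n) = \<sigma> n"
| "asubst \<sigma> (PNeg \<tau>) = ANeg (asubst \<sigma> \<tau>)"
| "asubst \<sigma> (PConj \<tau> \<rho>) = AConj (asubst \<sigma> \<tau>) (asubst \<sigma> \<rho>)"

primrec wsubst :: "(nat \<Rightarrow> ('ag, 'p, 'q) wform) \<Rightarrow> pform \<Rightarrow> ('ag, 'p, 'q) wform" where
  "wsubst \<sigma> (PVar n) = \<sigma> n"
| "wsubst \<sigma> (PNeg \<tau>) = WNeg (wsubst \<sigma> \<tau>)"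
| "wsubst \<sigma> (PConj \<tau> \<rho>) = WConj (wsubst \<sigma> \<tau>) (wsubst \<sigma> \<rho>)"

text \<open>
  The finite disjunction in the last axiom is admitted for every enumeration \<open>as\<close> of the agents
  and every choice of the formulas \<open>\<chi> a\<close>, \<open>X\<close> that make up \<open>\<top>\<close> at sort \<open>a\<close> and \<open>\<bottom>\<close> at the world
  sort. All these instances are interderivable by the remaining rules. The disjunction over no
  agents is \<open>\<bottom>\<close>.
\<close>

inductive aderiv ::
    "'ag set \<Rightarrow> ('ag \<Rightarrow> 'p set) \<Rightarrow> 'q set \<Rightarrow> 'ag \<Rightarrow> ('ag, 'p, 'q) aform \<Rightarrow> bool"
  and wderiv ::
    "'ag set \<Rightarrow> ('ag \<Rightarrow> 'p set) \<Rightarrow> 'q set \<Rightarrow> ('ag, 'p, 'q) wform \<Rightarrow> bool"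
  for A :: "'ag set" and AP :: "'ag \<Rightarrow> 'p set" and APe :: "'q set"
where
  ATaut: "tautology \<tau> \<Longrightarrow> agent_formula A AP APe a (asubst \<sigma> \<tau>) \<Longrightarrow>
    aderiv A AP APe a (asubst \<sigma> \<tau>)"
| WTaut: "tautology \<tau> \<Longrightarrow> world_formula A AP APe (wsubst \<sigma> \<tau>) \<Longrightarrow>
    wderiv A AP APe (wsubst \<sigma> \<tau>)"
| AMP: "aderiv A AP APe a (AImp \<phi> \<psi>) \<Longrightarrow> aderiv A AP APe a \<phi> \<Longrightarrow> aderiv A AP APe a \<psi>"
| WMP: "wderiv A AP APe (WImp \<Phi> \<Psi>) \<Longrightarrow> wderiv A AP APe \<Phi> \<Longrightarrow> wderiv A AP APe \<Psi>"
| ANec: "a \<in> A \<Longrightarrow> wderiv A AP APe \<Phi> \<Longrightarrow> aderiv A AP APe a (ABox a \<Phi>)"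
| WNec: "a \<in> A \<Longrightarrow> aderiv A AP APe a \<phi> \<Longrightarrow> wderiv A AP APe (WBox a \<phi>)"
| ADiaMono: "a \<in> A \<Longrightarrow> wderiv A AP APe (WImp \<Phi> \<Psi>) \<Longrightarrow>
    aderiv A AP APe a (AImp (ADia a \<Phi>) (ADia a \<Psi>))"
| ABoxMono: "a \<in> A \<Longrightarrow> wderiv A AP APe (WImp \<Phi> \<Psi>) \<Longrightarrow>
    aderiv A AP APe a (AImp (ABox a \<Phi>) (ABox a \<Psi>))"
| WDiaMono: "a \<in> A \<Longrightarrow> aderiv A AP APe a (AImp \<phi> \<psi>) \<Longrightarrow>
    wderiv A AP APe (WImp (WDia a \<phi>) (WDia a \<psi>))"
| WBoxMono: "a \<in> A \<Longrightarrow> aderiv A AP APe a (AImp \<phi> \<psi>) \<Longrightarrow>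
    wderiv A AP APe (WImp (WBox a \<phi>) (WBox a \<psi>))"
| Adj1: "a \<in> A \<Longrightarrow> wderiv A AP APe (WImp \<Phi> (WBox a \<psi>)) \<Longrightarrow>
    aderiv A AP APe a (AImp (ADia a \<Phi>) \<psi>)"
| Adj2: "a \<in> A \<Longrightarrow> aderiv A AP APe a (AImp (ADia a \<Phi>) \<psi>) \<Longrightarrow>
    wderiv A AP APe (WImp \<Phi> (WBox a \<psi>))"
| Adj3: "a \<in> A \<Longrightarrow> aderiv A AP APe a (AImp \<phi> (ABox a \<Psi>)) \<Longrightarrow>
    wderiv A AP APe (WImp (WDia a \<phi>) \<Psi>)"
| Adj4: "a \<in> A \<Longrightarrow> wderiv A AP APe (WImp (WDia a \<phi>) \<Psi>) \<Longrightarrow>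
    aderiv A AP APe a (AImp \<phi> (ABox a \<Psi>))"
| AxIn: "a \<in> A \<Longrightarrow> agent_formula A AP APe a \<phi> \<Longrightarrow>
    aderiv A AP APe a (AImp \<phi> (ADia a (WDia a \<phi>)))"
| AxOut: "a \<in> A \<Longrightarrow> agent_formula A AP APe a \<phi> \<Longrightarrow>
    aderiv A AP APe a (AImp (ADia a (WDia a \<phi>)) \<phi>)"
| AxAlive: "distinct as \<Longrightarrow> set as = A \<Longrightarrow> (\<And>a. a \<in> A \<Longrightarrow> agent_formula A AP APe a (\<chi> a)) \<Longrightarrow>
    world_formula A AP APe X \<Longrightarrow>
    wderiv A AP APe (foldr WDisj (map (\<lambda>a. WDia a (ATop (\<chi> a))) as) (WBot X))"

record ('ag, 'p, 'q, 'e, 'v) chmodel =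
  edges :: "'e set"
  views :: "'ag \<Rightarrow> 'v set"
  proj :: "'ag \<Rightarrow> 'e \<rightharpoonup> 'v"
  aval :: "'ag \<Rightarrow> 'p \<Rightarrow> 'v set"
  wval :: "'q \<Rightarrow> 'e set"

definition chromatic_hypergraph ::
    "'ag set \<Rightarrow> 'e set \<Rightarrow> ('ag \<Rightarrow> 'v set) \<Rightarrow> ('ag \<Rightarrow> 'e \<rightharpoonup> 'v) \<Rightarrow> bool" where
  "chromatic_hypergraph A E V \<pi> \<longleftrightarrow>
     (\<forall>a\<in>A. dom (\<pi> a) \<subseteq> E \<and> ran (\<pi> a) = V a) \<and>
     (\<forall>e\<in>E. \<exists>a\<in>A. \<pi> a e \<noteq> None)"

definition chromatic_hypergraph_model ::
    "'ag set \<Rightarrow> ('ag \<Rightarrow> 'p set) \<Rightarrow> 'q set \<Rightarrow> ('ag, 'p, 'q, 'e, 'v) chmodel \<Rightarrow> bool" where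
  "chromatic_hypergraph_model A AP APe H \<longleftrightarrow>
     chromatic_hypergraph A (edges H) (views H) (proj H) \<and>
     (\<forall>a\<in>A. \<forall>p\<in>AP a. aval H a p \<subseteq> views H a) \<and>
     (\<forall>p\<in>APe. wval H p \<subseteq> edges H)"

primrec asat :: "('ag, 'p, 'q, 'e, 'v) chmodel \<Rightarrow> 'ag \<Rightarrow> 'v \<Rightarrow> ('ag, 'p, 'q) aform \<Rightarrow> bool"
  and wsat :: "('ag, 'p, 'q, 'e, 'v) chmodel \<Rightarrow> 'e \<Rightarrow> ('ag, 'p, 'q) wform \<Rightarrow> bool"
where
  "asat H a v (AProp p) \<longleftrightarrow> v \<in> aval H a p"
| "asat H a v (ANeg \<phi>) \<longleftrightarrow> \<not> asat H a v \<phi>"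
| "asat H a v (AConj \<phi> \<psi>) \<longleftrightarrow> asat H a v \<phi> \<and> asat H a v \<psi>"
| "asat H a v (ADia b \<Phi>) \<longleftrightarrow> (\<exists>e\<in>edges H. proj H b e = Some v \<and> wsat H e \<Phi>)"
| "wsat H e (WProp p) \<longleftrightarrow> e \<in> wval H p"
| "wsat H e (WNeg \<Phi>) \<longleftrightarrow> \<not> wsat H e \<Phi>"
| "wsat H e (WConj \<Phi> \<Psi>) \<longleftrightarrow> wsat H e \<Phi> \<and> wsat H e \<Psi>"
| "wsat H e (WDia a \<phi>) \<longleftrightarrow> (\<exists>v. proj H a e = Some v \<and> asat H a v \<phi>)"

text \<open>
  HOL cannot quantify over types inside a formula, so the class of all models is represented by
  the models whose hyperedges and views are drawn from one sufficiently large pair of types: sets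
  of world formulas and sets of agent formulas. Validity over these models is implied by validity
  over all models, so completeness for them is at least as strong.
\<close>

type_synonym ('ag, 'p, 'q) chmodel_u =
  "('ag, 'p, 'q, ('ag, 'p, 'q) wform set, ('ag, 'p, 'q) aform set) chmodel"

end

theory Submission
  imports Defs
begin

text \<open>
  Canonical model: hyperedges are the ultrafilters of world formulas, views of \<open>a\<close> the ultrafilters
  of formulas of sort \<open>a\<close>, and \<open>\<pi>\<^sub>a(\<Gamma>) = {\<phi>. \<langle>a\<rangle>\<phi> \<in> \<Gamma>}\<close> unless this set is empty. The adjunction
  turns \<open>\<Diamond>\<^sub>a\<langle>a\<rangle>\<phi> \<rightarrow> \<phi>\<close> into \<open>\<langle>a\<rangle>\<phi> \<rightarrow> [a]\<phi>\<close>, which makes \<open>\<pi>\<^sub>a(\<Gamma>)\<close> consistent; it is complete because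
  left adjoints preserve joins. For an ultrafilter \<open>v\<close> of sort \<open>a\<close> the set \<open>{\<Psi>. \<box>\<^sub>a\<Psi> \<in> v}\<close> is a
  filter containing \<open>\<langle>a\<rangle>\<phi>\<close> for all \<open>\<phi> \<in> v\<close>, so every ultrafilter above it projects to \<open>v\<close>. This
  gives the existence part of the truth lemma, and with \<open>\<phi> \<rightarrow> \<Diamond>\<^sub>a\<langle>a\<rangle>\<phi>\<close> also surjectivity of \<open>\<pi>\<^sub>a\<close>.
\<close>

section \<open>Propositional calculus, filters and ultrafilters, for all sorts at once\<close>

locale prop_logic =
  fixes F D :: "'f \<Rightarrow> bool" and neg :: "'f \<Rightarrow> 'f" and conj :: "'f \<Rightarrow> 'f \<Rightarrow> 'f"
    and sub :: "(nat \<Rightarrow> 'f) \<Rightarrow> pform \<Rightarrow> 'f"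
  assumes F_neg [simp]: "F (neg x) \<longleftrightarrow> F x"
    and F_conj [simp]: "F (conj x y) \<longleftrightarrow> F x \<and> F y"
    and D_F: "D x \<Longrightarrow> F x"
    and sub_simps [simp]: "sub \<sigma> (PVar n) = \<sigma> n" "sub \<sigma> (PNeg \<tau>) = neg (sub \<sigma> \<tau>)"
      "sub \<sigma> (PConj \<tau> \<rho>) = conj (sub \<sigma> \<tau>) (sub \<sigma> \<rho>)"
    and D_taut: "tautology \<tau> \<Longrightarrow> F (sub \<sigma> \<tau>) \<Longrightarrow> D (sub \<sigma> \<tau>)"
    and D_mp: "D (neg (conj x (neg y))) \<Longrightarrow> D x \<Longrightarrow> D y"
begin

abbreviation imp :: "'f \<Rightarrow> 'f \<Rightarrow> 'f" where
  "imp x y \<equiv> neg (conj x (neg y))"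

abbreviation pimp :: "pform \<Rightarrow> pform \<Rightarrow> pform" where
  "pimp \<tau> \<rho> \<equiv> PNeg (PConj \<tau> (PNeg \<rho>))"

text \<open>Instantiates schemes in the variables 0, 1, 2; schemes with fewer variables repeat a
  formula as filler.\<close>

lemma D_taut3:
  assumes "tautology \<tau>" "F (sub ((!) [x, y, z]) \<tau>)" "sub ((!) [x, y, z]) \<tau> = w"
  shows "D w"
  using D_taut[OF assms(1,2)] assms(3) by simp

lemma D_imp_refl: "F x \<Longrightarrow> D (imp x x)"
  by (rule D_taut3[of "pimp (PVar 0) (PVar 0)" x x x]) (auto simp: tautology_def)

lemma D_imp_const: "F x \<Longrightarrow> F y \<Longrightarrow> D (imp x (imp y x))"
  by (rule D_taut3[of "pimp (PVar 0) (pimp (PVar 1) (PVar 0))" x y x])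
    (auto simp: tautology_def)

lemma D_imp_distrib:
  "F x \<Longrightarrow> F y \<Longrightarrow> F z \<Longrightarrow> D (imp (imp x (imp y z)) (imp (imp x y) (imp x z)))"
  by (rule D_taut3[of "pimp (pimp (PVar 0) (pimp (PVar 1) (PVar 2)))
        (pimp (pimp (PVar 0) (PVar 1)) (pimp (PVar 0) (PVar 2)))" x y z])
    (auto simp: tautology_def)

lemma D_cases: "F x \<Longrightarrow> F y \<Longrightarrow> D (imp (imp x y) (imp (imp (neg x) y) y))"
  by (rule D_taut3[of "pimp (pimp (PVar 0) (PVar 1))
        (pimp (pimp (PNeg (PVar 0)) (PVar 1)) (PVar 1))" x y x])
    (auto simp: tautology_def)

lemma D_explosion: "F x \<Longrightarrow> F y \<Longrightarrow> D (imp x (imp (neg x) y))"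
  by (rule D_taut3[of "pimp (PVar 0) (pimp (PNeg (PVar 0)) (PVar 1))" x y x])
    (auto simp: tautology_def)

lemma D_conj1: "F x \<Longrightarrow> F y \<Longrightarrow> D (imp (conj x y) x)"
  by (rule D_taut3[of "pimp (PConj (PVar 0) (PVar 1)) (PVar 0)" x y x])
    (auto simp: tautology_def)

lemma D_conj2: "F x \<Longrightarrow> F y \<Longrightarrow> D (imp (conj x y) y)"
  by (rule D_taut3[of "pimp (PConj (PVar 0) (PVar 1)) (PVar 1)" x y x])
    (auto simp: tautology_def)

lemma D_conjI: "F x \<Longrightarrow> F y \<Longrightarrow> D (imp x (imp y (conj x y)))"
  by (rule D_taut3[of "pimp (PVar 0) (pimp (PVar 1) (PConj (PVar 0) (PVar 1)))" x y x])
    (auto simp: tautology_def)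

definition filt :: "'f set \<Rightarrow> bool" where
  "filt T \<longleftrightarrow> (\<forall>x\<in>T. F x) \<and> (\<forall>x. D x \<longrightarrow> x \<in> T) \<and> (\<forall>x y. imp x y \<in> T \<longrightarrow> x \<in> T \<longrightarrow> y \<in> T)"

definition ultra :: "'f set \<Rightarrow> bool" where
  "ultra M \<longleftrightarrow> filt M \<and> (\<forall>x. F x \<longrightarrow> (neg x \<in> M \<longleftrightarrow> x \<notin> M))"

lemma filt_F: "filt T \<Longrightarrow> x \<in> T \<Longrightarrow> F x"
  and filt_D: "filt T \<Longrightarrow> D x \<Longrightarrow> x \<in> T"
  and filt_mp: "filt T \<Longrightarrow> imp x y \<in> T \<Longrightarrow> x \<in> T \<Longrightarrow> y \<in> T"
  unfolding filt_def by blast+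

lemma filt_Collect_D: "filt (Collect D)"
  unfolding filt_def using D_F D_mp by auto

text \<open>The deduction theorem: this is the filter generated by \<open>T\<close> and
  \<open>z\<close>. Closure under modus ponens is the S axiom, membership of theorems the K
  axiom.\<close>

lemma filt_adjoin:
  assumes T: "filt T" and z: "F z"
  shows "filt {w. imp z w \<in> T}"
  unfolding filt_def
proof (intro conjI ballI allI impI)
  fix x assume "x \<in> {w. imp z w \<in> T}"
  then show "F x" using filt_F[OF T, of "imp z x"] by simp
next
  fix x assume "D x"
  then show "x \<in> {w. imp z w \<in> T}"
    using filt_mp[OF T] filt_D[OF T] D_imp_const[OF D_F z] by blast
next
  fix x y assume "imp x y \<in> {w. imp z w \<in> T}" and zx: "x \<in> {w. imp z w \<in> T}"
  then have zxy: "imp z (imp x y) \<in> T" by simp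
  then have "F x" "F y" using filt_F[OF T zxy] by simp_all
  then show "y \<in> {w. imp z w \<in> T}"
    using filt_mp[OF T filt_mp[OF T filt_D[OF T D_imp_distrib] zxy]] z zx by blast
qed

text \<open>Zorn's lemma gives a filter maximal among those that extend \<open>T\<close> and omit
  \<open>y\<close>. Such a filter decides every formula.\<close>

lemma ultra_extension:
  assumes T: "filt T" and y: "F y" "y \<notin> T"
  obtains M where "ultra M" "T \<subseteq> M" "y \<notin> M"
proof -
  let ?S = "{M. filt M \<and> T \<subseteq> M \<and> y \<notin> M}"
  have "\<exists>M\<in>?S. \<forall>X\<in>?S. M \<subseteq> X \<longrightarrow> X = M"
  proof (rule subset_Zorn_nonempty)
    show "?S \<noteq> {}" using T y by blast
    fix C assume C: "C \<noteq> {}" "subset.chain ?S C"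
    have "filt (\<Union>C)"
      unfolding filt_def
    proof (intro conjI ballI allI impI)
      fix u w assume "imp u w \<in> \<Union>C" "u \<in> \<Union>C"
      then obtain M N where "M \<in> C" "N \<in> C" "imp u w \<in> M" "u \<in> N" by blast
      moreover from this have "M \<subseteq> N \<or> N \<subseteq> M" "filt M" "filt N"
        using C(2) unfolding subset_chain_def by blast+
      ultimately show "w \<in> \<Union>C" using filt_mp by blast
    next
      fix u assume "D u"
      moreover obtain N where "N \<in> C" "filt N" using C unfolding subset_chain_def by blast
      ultimately show "u \<in> \<Union>C" using filt_D by blast
    qed (use C in \<open>auto simp: subset_chain_def dest: filt_F\<close>)
    then show "\<Union>C \<in> ?S" using C unfolding subset_chain_def by blast
  qed
  then obtain M where "M \<in> ?S" and M_max: "\<forall>X\<in>?S. M \<subseteq> X \<longrightarrow> X = M" ..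
  then have M: "filt M" "T \<subseteq> M" "y \<notin> M" by simp_all
  have max: "X = M" if "filt X" "M \<subseteq> X" "y \<notin> X" for X
    using M_max M(2) that by simp
  \<comment> \<open>Otherwise adjoining \<open>z\<close> would give a strictly larger filter that
    still omits \<open>y\<close>.\<close>
  have imp_y: "imp z y \<in> M" if "F z" "z \<notin> M" for z
  proof (rule ccontr)
    assume "imp z y \<notin> M"
    moreover have "M \<subseteq> {w. imp z w \<in> M}"
    proof
      fix w assume w: "w \<in> M"
      then have "D (imp w (imp z w))" using D_imp_const filt_F[OF M(1)] that(1) by blast
      then show "w \<in> {w. imp z w \<in> M}" using filt_mp[OF M(1) filt_D[OF M(1)] w] by blast
    qed
    ultimately have "{w. imp z w \<in> M} = M"
      using max[OF filt_adjoin[OF M(1) that(1)]] by blast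
    then show False using filt_D[OF M(1) D_imp_refl] that by blast
  qed
  \<comment> \<open>Here \<open>y\<close> plays the role of falsum: both explosion and the case
    split on \<open>z\<close> would put \<open>y\<close> into \<open>M\<close>.\<close>
  have "neg z \<in> M \<longleftrightarrow> z \<notin> M" if z: "F z" for z
  proof
    assume "neg z \<in> M"
    then show "z \<notin> M"
      using filt_mp[OF M(1) filt_mp[OF M(1) filt_D[OF M(1) D_explosion[OF z y(1)]]]] M(3) by blast
  next
    assume "z \<notin> M"
    then show "neg z \<in> M"
      using filt_mp[OF M(1) filt_mp[OF M(1) filt_D[OF M(1) D_cases[OF z y(1)]]]] M(3)
        imp_y[OF z] imp_y[of "neg z"] z by auto
  qed
  then have "ultra M" unfolding ultra_def using M(1) by blast
  then show ?thesis using that M by blast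
qed

lemma ultra_filt: "ultra M \<Longrightarrow> filt M"
  unfolding ultra_def by blast

lemma ultra_F: "ultra M \<Longrightarrow> x \<in> M \<Longrightarrow> F x"
  using ultra_filt filt_F by blast

lemma ultra_D: "ultra M \<Longrightarrow> D x \<Longrightarrow> x \<in> M"
  using ultra_filt filt_D by blast

lemma ultra_neg: "ultra M \<Longrightarrow> neg x \<in> M \<longleftrightarrow> F x \<and> x \<notin> M"
  using ultra_F unfolding ultra_def by fastforce

lemma ultra_conj: "ultra M \<Longrightarrow> conj x y \<in> M \<longleftrightarrow> x \<in> M \<and> y \<in> M"
  using filt_mp[OF ultra_filt] ultra_D[OF _ D_conj1] ultra_D[OF _ D_conj2] ultra_D[OF _ D_conjI]
    ultra_F F_conj by metis

lemma ultra_imp_D: "ultra M \<Longrightarrow> D (imp x y) \<Longrightarrow> x \<in> M \<Longrightarrow> y \<in> M"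
  using filt_mp ultra_D ultra_filt by blast

lemmas ultra_simps = ultra_neg ultra_conj

text \<open>Allows propositional derivations to be replaced by Boolean reasoning about membership in
  ultrafilters.\<close>

lemma D_if_in_all_ultra:
  assumes "F x" "\<And>M. ultra M \<Longrightarrow> x \<in> M"
  shows "D x"
  using ultra_extension[OF filt_Collect_D assms(1)] assms(2) by blast

lemma ultra_eq:
  assumes "ultra M" "ultra N" "M \<subseteq> N"
  shows "M = N"
  using assms ultra_neg ultra_F by blast

end

section \<open>Well-sortedness of formulas and theorems\<close>

lemma agent_formula_simps [simp]:
  "agent_formula A AP APe a (AProp p) \<longleftrightarrow> a \<in> A \<and> p \<in> AP a"
  "agent_formula A AP APe a (ANeg \<phi>) \<longleftrightarrow> agent_formula A AP APe a \<phi>"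
  "agent_formula A AP APe a (AConj \<phi> \<psi>) \<longleftrightarrow>
    agent_formula A AP APe a \<phi> \<and> agent_formula A AP APe a \<psi>"
  "agent_formula A AP APe a (ADia b \<Phi>) \<longleftrightarrow> b = a \<and> a \<in> A \<and> world_formula A AP APe \<Phi>"
  by (auto intro: agent_formula_world_formula.intros elim: agent_formula.cases)

lemma world_formula_simps [simp]:
  "world_formula A AP APe (WProp q) \<longleftrightarrow> q \<in> APe"
  "world_formula A AP APe (WNeg \<Phi>) \<longleftrightarrow> world_formula A AP APe \<Phi>"
  "world_formula A AP APe (WConj \<Phi> \<Psi>) \<longleftrightarrow> world_formula A AP APe \<Phi> \<and> world_formula A AP APe \<Psi>"
  "world_formula A AP APe (WDia a \<phi>) \<longleftrightarrow> a \<in> A \<and> agent_formula A AP APe a \<phi>"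
  by (auto intro: agent_formula_world_formula.intros elim: world_formula.cases)

lemma world_formula_foldr_WDisj:
  "world_formula A AP APe (foldr WDisj \<Phi>s \<Psi>) \<longleftrightarrow>
    (\<forall>\<Phi>\<in>set \<Phi>s. world_formula A AP APe \<Phi>) \<and> world_formula A AP APe \<Psi>"
  by (induction \<Phi>s) auto

lemma aderiv_agent_formula: "aderiv A AP APe a \<phi> \<Longrightarrow> agent_formula A AP APe a \<phi>"
  and wderiv_world_formula: "wderiv A AP APe \<Phi> \<Longrightarrow> world_formula A AP APe \<Phi>"
  by (induction rule: aderiv_wderiv.inducts) (auto simp: world_formula_foldr_WDisj)

section \<open>Consequences of the adjunctions\<close>

locale two_ch =
  fixes A :: "'ag set" and AP :: "'ag \<Rightarrow> 'p set" and APe :: "'q set"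
begin

abbreviation "Fa \<equiv> agent_formula A AP APe"
abbreviation "Fw \<equiv> world_formula A AP APe"
abbreviation "Da \<equiv> aderiv A AP APe"
abbreviation "Dw \<equiv> wderiv A AP APe"

sublocale ag: prop_logic "Fa a" "Da a" ANeg AConj asubst for a
  by unfold_locales (auto intro: aderiv_agent_formula ATaut AMP)

sublocale wo: prop_logic Fw Dw WNeg WConj wsubst
  by unfold_locales (auto intro: wderiv_world_formula WTaut WMP)

text \<open>Unit of the adjunction between \<open>WDia a\<close> and \<open>ABox a\<close>: the
  transpose of the identity. \<open>Dw_unit\<close> is its counterpart for \<open>ADia a\<close> and
  \<open>WBox a\<close>.\<close>

lemma Da_unit: "a \<in> A \<Longrightarrow> Fa a \<phi> \<Longrightarrow> Da a (AImp \<phi> (ABox a (WDia a \<phi>)))"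
  by (intro Adj4 wo.D_imp_refl) auto

lemma Dw_unit: "a \<in> A \<Longrightarrow> Fw \<Phi> \<Longrightarrow> Dw (WImp \<Phi> (WBox a (ADia a \<Phi>)))"
  by (intro Adj2 ag.D_imp_refl) auto

lemma Dw_functional: "a \<in> A \<Longrightarrow> Fa a \<phi> \<Longrightarrow> Dw (WImp (WDia a \<phi>) (WBox a \<phi>))"
  by (intro Adj2 AxOut)

text \<open>The hypothesis \<open>join\<close> expresses that \<open>\<theta>\<close> entails the
  disjunction of \<open>\<phi>\<close> and \<open>\<psi>\<close>. Both disjuncts entail
  \<open>ABox a\<close> of the disjunction of their diamonds, hence so does \<open>\<theta>\<close>;
  transposing back gives the claim.\<close>

lemma WDia_join:
  assumes a: "a \<in> A" and \<Gamma>: "wo.ultra \<Gamma>" and \<theta>: "WDia a \<theta> \<in> \<Gamma>" and F: "Fa a \<phi>" "Fa a \<psi>"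
    and join: "\<And>v. ag.ultra a v \<Longrightarrow> \<theta> \<in> v \<Longrightarrow> \<phi> \<in> v \<or> \<psi> \<in> v"
  shows "WDia a \<phi> \<in> \<Gamma> \<or> WDia a \<psi> \<in> \<Gamma>"
proof -
  let ?\<Psi> = "WDisj (WDia a \<phi>) (WDia a \<psi>)"
  have \<theta>F: "Fa a \<theta>" using wo.ultra_F[OF \<Gamma> \<theta>] by simp
  have box: "Da a (AImp \<chi> (ABox a ?\<Psi>))" if "\<chi> = \<phi> \<or> \<chi> = \<psi>" for \<chi>
    by (intro Adj4 a wo.D_if_in_all_ultra) (use that a F in \<open>auto simp: wo.ultra_simps\<close>)
  have "Da a (AImp \<theta> (ABox a ?\<Psi>))"
  proof (rule ag.D_if_in_all_ultra)
    fix v assume v: "ag.ultra a v"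
    then have "\<theta> \<in> v \<Longrightarrow> ABox a ?\<Psi> \<in> v"
      using ag.ultra_imp_D[OF v box] join[OF v] by blast
    then show "AImp \<theta> (ABox a ?\<Psi>) \<in> v"
      using v a F \<theta>F by (auto simp: ag.ultra_simps)
  qed (use a F \<theta>F in simp)
  then have "?\<Psi> \<in> \<Gamma>" using wo.ultra_imp_D[OF \<Gamma> Adj3[OF a] \<theta>] by blast
  then show ?thesis using \<Gamma> a F by (simp add: wo.ultra_simps)
qed

text \<open>Axiom K for the box, obtained from the adjunction: the diamond of the premise entails
  both \<open>WImp \<Phi> \<Psi>\<close> and \<open>\<Phi>\<close>, hence
  \<open>\<Psi>\<close>.\<close>

lemma Da_box_mp:
  assumes a: "a \<in> A" and F: "Fw \<Phi>" "Fw \<Psi>"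
  shows "Da a (AImp (AConj (ABox a (WImp \<Phi> \<Psi>)) (ABox a \<Phi>)) (ABox a \<Psi>))" (is "Da a (AImp ?\<theta> _)")
proof -
  have "Dw (WImp (WDia a ?\<theta>) (WImp \<Phi> \<Psi>))"
    by (intro Adj3[OF a] ag.D_conj1) (use a F in simp_all)
  moreover have "Dw (WImp (WDia a ?\<theta>) \<Phi>)"
    by (intro Adj3[OF a] ag.D_conj2) (use a F in simp_all)
  moreover have "Fw (WDia a ?\<theta>)" using a F by simp
  ultimately have "Dw (WImp (WDia a ?\<theta>) \<Psi>)"
    using WMP[OF WMP[OF wo.D_imp_distrib]] F by blast
  then show ?thesis by (rule Adj4[OF a])
qed

section \<open>Projection of world ultrafilters to agent ultrafilters\<close>

definition view :: "'ag \<Rightarrow> ('ag, 'p, 'q) wform set \<Rightarrow> ('ag, 'p, 'q) aform set" where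
  "view a \<Gamma> = {\<phi>. WDia a \<phi> \<in> \<Gamma>}"

lemma ultra_view:
  assumes a: "a \<in> A" and \<Gamma>: "wo.ultra \<Gamma>" and ne: "view a \<Gamma> \<noteq> {}"
  shows "ag.ultra a (view a \<Gamma>)"
proof -
  obtain \<theta> where \<theta>: "WDia a \<theta> \<in> \<Gamma>" using ne unfolding view_def by blast
  have F: "Fa a \<phi>" if "WDia a \<phi> \<in> \<Gamma>" for \<phi>
    using wo.ultra_F[OF \<Gamma> that] by simp
  \<comment> \<open>Consistency is functionality; completeness is \<open>WDia_join\<close> below
    \<open>\<theta>\<close>, as every ultrafilter contains \<open>\<phi>\<close> or its
    negation.\<close>
  have neg: "WDia a (ANeg \<phi>) \<in> \<Gamma> \<longleftrightarrow> WDia a \<phi> \<notin> \<Gamma>" if "Fa a \<phi>" for \<phi>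
    using wo.ultra_imp_D[OF \<Gamma> Dw_functional[OF a that]]
      WDia_join[OF a \<Gamma> \<theta>, of \<phi> "ANeg \<phi>"] \<Gamma> a that
    by (auto simp: wo.ultra_simps ag.ultra_simps)
  have mono: "WDia a \<psi> \<in> \<Gamma>" if "WDia a \<phi> \<in> \<Gamma>" "Da a (AImp \<phi> \<psi>)" for \<phi> \<psi>
    using wo.ultra_imp_D[OF \<Gamma> WDiaMono[OF a that(2)] that(1)] .
  have D: "WDia a \<phi> \<in> \<Gamma>" if "Da a \<phi>" for \<phi>
    using mono[OF \<theta>] that F[OF \<theta>] ag.D_F[OF that]
    by (meson AMP ag.D_imp_const)
  \<comment> \<open>The implication splits as a join of \<open>ANeg \<phi>\<close> and
    \<open>\<psi>\<close>, and \<open>neg\<close> excludes the first.\<close>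
  have mp: "WDia a \<psi> \<in> \<Gamma>" if "WDia a (AImp \<phi> \<psi>) \<in> \<Gamma>" "WDia a \<phi> \<in> \<Gamma>" for \<phi> \<psi>
  proof -
    have "Fa a \<phi>" "Fa a \<psi>" using F[OF that(1)] by simp_all
    then show ?thesis
      using WDia_join[OF a \<Gamma> that(1), of "ANeg \<phi>" \<psi>] neg that(2) by (auto simp: ag.ultra_simps)
  qed
  show ?thesis
    unfolding ag.ultra_def ag.filt_def view_def using F neg D mp by blast
qed

lemma filt_box:
  assumes a: "a \<in> A" and v: "ag.ultra a v"
  shows "wo.filt {\<Psi>. ABox a \<Psi> \<in> v}"
  unfolding wo.filt_def
proof (intro conjI ballI allI impI)
  fix \<Phi> assume "\<Phi> \<in> {\<Psi>. ABox a \<Psi> \<in> v}"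
  then show "Fw \<Phi>" using ag.ultra_F[OF v, of "ABox a \<Phi>"] by simp
next
  fix \<Phi> assume "Dw \<Phi>"
  then show "\<Phi> \<in> {\<Psi>. ABox a \<Psi> \<in> v}" using ag.ultra_D[OF v ANec[OF a]] by simp
next
  fix \<Phi> \<Psi> assume imp: "WImp \<Phi> \<Psi> \<in> {\<Psi>. ABox a \<Psi> \<in> v}" and \<Phi>: "\<Phi> \<in> {\<Psi>. ABox a \<Psi> \<in> v}"
  then have "Fw \<Phi>" "Fw \<Psi>" using ag.ultra_F[OF v, of "ABox a (WImp \<Phi> \<Psi>)"] by simp_all
  then have "ABox a \<Psi> \<in> v"
    using imp \<Phi>
    by (intro ag.ultra_imp_D[OF v Da_box_mp[OF a]])
      (simp_all only: ag.ultra_conj[OF v] mem_Collect_eq)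
  then show "\<Psi> \<in> {\<Psi>. ABox a \<Psi> \<in> v}" by simp
qed

lemma ADia_in_ultra:
  assumes a: "a \<in> A" and v: "ag.ultra a v" and \<Phi>: "ADia a \<Phi> \<in> v"
  obtains \<Gamma> where "wo.ultra \<Gamma>" "\<Phi> \<in> \<Gamma>" "view a \<Gamma> = v"
proof -
  have F: "Fw \<Phi>" using ag.ultra_F[OF v \<Phi>] by simp
  \<comment> \<open>\<open>ABox a (WNeg \<Phi>)\<close> unfolds to a negated diamond of a double
    negation, so the diamond in \<open>v\<close> is brought to that shape.\<close>
  have "Dw (WImp \<Phi> (WNeg (WNeg \<Phi>)))"
    using F by (intro wo.D_if_in_all_ultra) (auto simp: wo.ultra_simps)
  then have "ADia a (WNeg (WNeg \<Phi>)) \<in> v"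
    using ag.ultra_imp_D[OF v ADiaMono[OF a]] \<Phi> by blast
  then have "WNeg \<Phi> \<notin> {\<Psi>. ABox a \<Psi> \<in> v}" by (simp add: ag.ultra_neg[OF v])
  then obtain \<Gamma> where \<Gamma>: "wo.ultra \<Gamma>" and sub: "{\<Psi>. ABox a \<Psi> \<in> v} \<subseteq> \<Gamma>" and n: "WNeg \<Phi> \<notin> \<Gamma>"
    using wo.ultra_extension[OF filt_box[OF a v], of "WNeg \<Phi>"] F by auto
  have le: "v \<subseteq> view a \<Gamma>"
  proof
    fix \<phi> assume \<phi>: "\<phi> \<in> v"
    then have "ABox a (WDia a \<phi>) \<in> v"
      using ag.ultra_imp_D[OF v Da_unit[OF a]] ag.ultra_F[OF v] by blast
    then show "\<phi> \<in> view a \<Gamma>" using sub unfolding view_def by blast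
  qed
  \<comment> \<open>The view is nonempty because it contains \<open>ADia a \<Phi>\<close>; by
    maximality the inclusion is then an equality.\<close>
  then have "ag.ultra a (view a \<Gamma>)" using ultra_view[OF a \<Gamma>] \<Phi> by blast
  then have "view a \<Gamma> = v" using ag.ultra_eq[OF v _ le] by blast
  moreover have "\<Phi> \<in> \<Gamma>" using n F by (simp add: wo.ultra_neg[OF \<Gamma>])
  ultimately show ?thesis using that \<Gamma> by blast
qed

text \<open>By the unit, \<open>\<Gamma>\<close> contains \<open>WBox a (ADia a \<Phi>)\<close>,
  which keeps the negation of \<open>ADia a \<Phi>\<close> out of the view; the view is
  complete.\<close>

lemma ADia_in_view:
  assumes a: "a \<in> A" and \<Gamma>: "wo.ultra \<Gamma>" and ne: "view a \<Gamma> \<noteq> {}" and \<Phi>: "\<Phi> \<in> \<Gamma>"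
  shows "ADia a \<Phi> \<in> view a \<Gamma>"
proof -
  have "Fw \<Phi>" using wo.ultra_F[OF \<Gamma> \<Phi>] .
  then have "WBox a (ADia a \<Phi>) \<in> \<Gamma>" using wo.ultra_imp_D[OF \<Gamma> Dw_unit[OF a] \<Phi>] by blast
  then have "ANeg (ADia a \<Phi>) \<notin> view a \<Gamma>" unfolding view_def by (simp add: wo.ultra_neg[OF \<Gamma>])
  then show ?thesis using ag.ultra_neg[OF ultra_view[OF a \<Gamma> ne]] a \<open>Fw \<Phi>\<close> by simp
qed

section \<open>Canonical model and truth lemma\<close>

definition canonical :: "('ag, 'p, 'q) chmodel_u" where
  "canonical = \<lparr>edges = Collect wo.ultra, views = (\<lambda>a. Collect (ag.ultra a)),
     proj = (\<lambda>a \<Gamma>. if wo.ultra \<Gamma> \<and> view a \<Gamma> \<noteq> {} then Some (view a \<Gamma>) else None),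
     aval = (\<lambda>a p. {v. ag.ultra a v \<and> AProp p \<in> v}), wval = (\<lambda>q. {\<Gamma>. wo.ultra \<Gamma> \<and> WProp q \<in> \<Gamma>})\<rparr>"

lemma canonical_simps [simp]:
  "edges canonical = Collect wo.ultra"
  "views canonical a = Collect (ag.ultra a)"
  "proj canonical a \<Gamma> = Some v \<longleftrightarrow> wo.ultra \<Gamma> \<and> view a \<Gamma> \<noteq> {} \<and> view a \<Gamma> = v"
  "proj canonical a \<Gamma> = None \<longleftrightarrow> \<not> (wo.ultra \<Gamma> \<and> view a \<Gamma> \<noteq> {})"
  "aval canonical a p = {v. ag.ultra a v \<and> AProp p \<in> v}"
  "wval canonical q = {\<Gamma>. wo.ultra \<Gamma> \<and> WProp q \<in> \<Gamma>}"
  unfolding canonical_def by auto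

lemma truth:
  "Fa a \<phi> \<Longrightarrow> ag.ultra a v \<Longrightarrow> asat canonical a v \<phi> \<longleftrightarrow> \<phi> \<in> v"
  "Fw \<Phi> \<Longrightarrow> wo.ultra \<Gamma> \<Longrightarrow> wsat canonical \<Gamma> \<Phi> \<longleftrightarrow> \<Phi> \<in> \<Gamma>"
proof (induction \<phi> and \<Phi> arbitrary: a v and \<Gamma>)
  case (ADia b \<Phi>)
  \<comment> \<open>Satisfaction of \<open>ADia b\<close> uses the projection of \<open>b\<close>
    whatever the sort of the view; well-sortedness identifies the two.\<close>
  then have b: "b = a" "a \<in> A" and \<Phi>: "Fw \<Phi>" by simp_all
  show ?case
  proof
    assume "asat canonical a v (ADia b \<Phi>)"
    then obtain \<Gamma> where "wo.ultra \<Gamma>" "view a \<Gamma> \<noteq> {}" "view a \<Gamma> = v" "\<Phi> \<in> \<Gamma>"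
      using ADia.IH[OF \<Phi>] b by auto
    then show "ADia b \<Phi> \<in> v" using ADia_in_view b by blast
  next
    assume "ADia b \<Phi> \<in> v"
    then obtain \<Gamma> where "wo.ultra \<Gamma>" "\<Phi> \<in> \<Gamma>" "view a \<Gamma> = v"
      using ADia_in_ultra[OF b(2) ADia.prems(2)] b(1) by blast
    then show "asat canonical a v (ADia b \<Phi>)"
      using ADia.IH[OF \<Phi>] b \<open>ADia b \<Phi> \<in> v\<close> by auto
  qed
next
  case (WDia a \<phi>)
  then have a: "a \<in> A" "Fa a \<phi>" by simp_all
  have "wsat canonical \<Gamma> (WDia a \<phi>) \<longleftrightarrow> view a \<Gamma> \<noteq> {} \<and> \<phi> \<in> view a \<Gamma>"
    using WDia.IH[OF a(2)] ultra_view[OF a(1) WDia.prems(2)] WDia.prems(2) by auto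
  then show ?case unfolding view_def by blast
qed (auto simp: ag.ultra_simps wo.ultra_simps)

lemma ultra_foldr_WDisj:
  assumes "wo.ultra \<Gamma>" "foldr WDisj \<Phi>s \<Psi> \<in> \<Gamma>"
  shows "\<Psi> \<in> \<Gamma> \<or> (\<exists>\<Phi>\<in>set \<Phi>s. \<Phi> \<in> \<Gamma>)"
  using assms by (induction \<Phi>s) (auto simp: wo.ultra_simps)

text \<open>Without any world formula the empty set would be an ultrafilter and hence a dead hyperedge.\<close>

lemma canonical_model:
  assumes "finite A" and X: "Fw X"
  shows "chromatic_hypergraph_model A AP APe canonical"
proof -
  have "\<exists>a\<in>A. view a \<Gamma> \<noteq> {}" if \<Gamma>: "wo.ultra \<Gamma>" for \<Gamma>
  proof -
    obtain as where as: "set as = A" "distinct as" using finite_distinct_list[OF assms(1)] by blast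
    \<comment> \<open>The single world formula \<open>X\<close> supplies \<open>ADia a X\<close>,
      and so a formula for truth, at the sort of every agent.\<close>
    have "Dw (foldr WDisj (map (\<lambda>a. WDia a (ATop (ADia a X))) as) (WBot X))"
      using AxAlive[OF as(2,1), of AP APe "\<lambda>a. ADia a X" X] X by simp
    then have "\<exists>a\<in>A. WDia a (ATop (ADia a X)) \<in> \<Gamma>"
      using ultra_foldr_WDisj[OF \<Gamma> wo.ultra_D[OF \<Gamma>]] as(1) by (fastforce simp: wo.ultra_simps[OF \<Gamma>])
    then show ?thesis unfolding view_def by blast
  qed
  moreover have "ran (proj canonical a) = Collect (ag.ultra a)" if a: "a \<in> A" for a
  proof
    show "ran (proj canonical a) \<subseteq> Collect (ag.ultra a)"
      using ultra_view[OF a] by (auto simp: ran_def)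
    show "Collect (ag.ultra a) \<subseteq> ran (proj canonical a)"
    proof
      fix v assume "v \<in> Collect (ag.ultra a)"
      then have v: "ag.ultra a v" by simp
      \<comment> \<open>Truth lies in \<open>v\<close>, so \<open>AxIn\<close> provides a diamond
        formula in \<open>v\<close> to which the existence lemma applies. It also witnesses the
        nonemptiness that \<open>proj\<close> demands.\<close>
      define \<phi> where "\<phi> = ATop (ADia a X)"
      have "Fa a \<phi>" and \<phi>: "\<phi> \<in> v"
        using a X v by (auto simp: \<phi>_def ag.ultra_simps)
      then have "ADia a (WDia a \<phi>) \<in> v" using ag.ultra_imp_D[OF v AxIn[OF a]] by blast
      then obtain \<Gamma> where "wo.ultra \<Gamma>" "view a \<Gamma> = v" using ADia_in_ultra[OF a v] by blast
      then show "v \<in> ran (proj canonical a)" using \<phi> by (auto simp: ran_def)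
    qed
  qed
  ultimately show ?thesis
    unfolding chromatic_hypergraph_model_def chromatic_hypergraph_def
    by (auto simp: dom_def)
qed

end

section \<open>Completeness at both sorts\<close>

theorem mainTheorem1:
  fixes A :: "'ag set" and AP :: "'ag \<Rightarrow> 'p set" and APe :: "'q set"
  assumes "finite A"
  shows "(\<forall>a\<in>A. \<forall>\<phi> :: ('ag, 'p, 'q) aform. agent_formula A AP APe a \<phi> \<longrightarrow>
            (\<forall>H :: ('ag, 'p, 'q) chmodel_u. chromatic_hypergraph_model A AP APe H \<longrightarrow>
              (\<forall>v\<in>views H a. asat H a v \<phi>)) \<longrightarrow>
            aderiv A AP APe a \<phi>) \<and>
         (\<forall>\<Phi> :: ('ag, 'p, 'q) wform. world_formula A AP APe \<Phi> \<longrightarrow>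
            (\<forall>H :: ('ag, 'p, 'q) chmodel_u. chromatic_hypergraph_model A AP APe H \<longrightarrow>
              (\<forall>e\<in>edges H. wsat H e \<Phi>)) \<longrightarrow>
            wderiv A AP APe \<Phi>)"
proof -
  interpret two_ch A AP APe .
  show ?thesis
  proof (intro conjI ballI allI impI)
    fix a \<phi>
    assume "a \<in> A" and \<phi>: "Fa a \<phi>"
      and valid: "\<forall>H :: ('ag, 'p, 'q) chmodel_u. chromatic_hypergraph_model A AP APe H \<longrightarrow>
        (\<forall>v\<in>views H a. asat H a v \<phi>)"
    then have "chromatic_hypergraph_model A AP APe canonical"
      \<comment> \<open>\<open>WDia a \<phi>\<close> shows that a world formula exists.\<close>
      by (intro canonical_model[OF assms, of "WDia a \<phi>"]) simp
    then show "Da a \<phi>"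
      using valid truth(1)[OF \<phi>] by (intro ag.D_if_in_all_ultra[OF \<phi>]) auto
  next
    fix \<Phi>
    assume \<Phi>: "Fw \<Phi>"
      and valid: "\<forall>H :: ('ag, 'p, 'q) chmodel_u. chromatic_hypergraph_model A AP APe H \<longrightarrow>
        (\<forall>e\<in>edges H. wsat H e \<Phi>)"
    then show "Dw \<Phi>"
      using canonical_model[OF assms \<Phi>] truth(2)[OF \<Phi>] by (intro wo.D_if_in_all_ultra[OF \<Phi>]) auto
  qed
qed

end
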